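(* The Fricke law recalled in the context gives the radial asymptotics, as $\varepsilon\downarrow0$, $$\binom{P_0(e^{-\varepsilon})}{P_1(e^{-\varepsilon})}=\frac1{\sqrt{13}}\exp\!\left(\frac{2\pi^2}{39\varepsilon}-\frac{\varepsilon}{6}\right)\left\{\binom{\alpha}{\beta}+O\!\left(e^{-4\pi^2/(13\varepsilon)}\right)\right\}.$$ The third product satisfies $P_2(e^{-\varepsilon})\sim\gamma\,e^{\Lambda/\varepsilon}/\sqrt{13}$ as $\varepsilon\downarrow0$, with $\Lambda=2\pi^2/39$.
   Context: With $(a_1,\dots,a_k;q)_\infty=\prod_{i=1}^k\prod_{n\ge0}(1-a_iq^n)$, $$P_0=(q,q^5,q^8,q^{12};q^{13})_\infty^{-1},\quad P_1=(q^2,q^3,q^{10},q^{11};q^{13})_\infty^{-1},\quad P_2=(q^4,q^6,q^7,q^9;q^{13})_\infty^{-1}.$$ With $\zeta=e^{2\pi i/13}$, $C_0=\{\pm1,\pm5\}$, $C_1=\{\pm2,\pm3\}$, $C_2=\{\pm4,\pm6\}$ (residues modulo $13$) and $\eta_j=\sum_{a\in C_j}\zeta^a$, put $\alpha=\eta_1-\eta_2$, $\beta=\eta_0-\eta_2$, $\gamma=\eta_1-\eta_0$. The Fricke law (previously established) is: for every $\tau$ in the upper half-plane, with $q=e^{2\pi i\tau}$, $q^t=e^{2\pi i t\tau}$, the vector $\mathbf H(\tau)=(q^{-1/6}P_0(q),\,q^{-1/6}P_1(q))^T$ satisfies $$\mathbf H\!\left(-\frac1{13\tau}\right)=S_{13}\mathbf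 H(\tau),\qquad S_{13}=\frac1{\sqrt{13}}\begin{pmatrix}\gamma&\beta\\\alpha&-\gamma\end{pmatrix},\qquad S_{13}^2=I.$$ One also has the known product relation $P_0=P_1+qP_2$. *)

theory Defs
  imports "HOL-Analysis.Analysis" "HOL-Library.Landau_Symbols"
begin

definition qpoch_inf :: "complex list \<Rightarrow> complex \<Rightarrow> complex" where
  "qpoch_inf as q = (\<Prod>a\<leftarrow>as. \<Prod>n. 1 - a * q ^ n)"

definition P0 :: "complex \<Rightarrow> complex" where
  "P0 q = inverse (qpoch_inf [q, q ^ 5, q ^ 8, q ^ 12] (q ^ 13))"

definition P1 :: "complex \<Rightarrow> complex" where
  "P1 q = inverse (qpoch_inf [q ^ 2, q ^ 3, q ^ 10, q ^ 11] (q ^ 13))"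

definition P2 :: "complex \<Rightarrow> complex" where
  "P2 q = inverse (qpoch_inf [q ^ 4, q ^ 6, q ^ 7, q ^ 9] (q ^ 13))"

definition zeta13 :: complex where
  "zeta13 = exp (2 * of_real pi * \<i> / 13)"

text \<open>The cosets of the cubic residues modulo 13, given by representatives; the period below
  depends only on the residue classes because \<^term>\<open>zeta13\<close> is a 13th root of unity.\<close>

definition C0 :: "int set" where "C0 = {1, -1, 5, -5}"
definition C1 :: "int set" where "C1 = {2, -2, 3, -3}"
definition C2 :: "int set" where "C2 = {4, -4, 6, -6}"

definition period :: "int set \<Rightarrow> complex" where
  "period C = (\<Sum>a\<in>C. zeta13 powi a)"

definition alpha :: complex where "alpha = period C1 - period C2"
definition beta :: complex where "beta = period C0 - period C2"
definition gamma :: complex where "gamma = period C1 - period C0"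

definition Lam :: real where "Lam = 2 * pi ^ 2 / 39"

end

theory Submission
  imports Defs "HOL-Complex_Analysis.Complex_Analysis" "HOL-Real_Asymp.Real_Asymp"
begin

text \<open>
  Each of the three products is the reciprocal of the product of two theta functions
  \<open>\<theta>(w; q) = \<Prod>\<^sub>n (1 - w q\<^sup>n) (1 - q\<^sup>n\<^sup>+\<^sup>1 / w)\<close> taken at \<open>w = q\<^sup>a\<close> with nome \<open>q\<^sup>1\<^sup>3\<close>, because the
  exponents occur in pairs \<open>a\<close>, \<open>13 - a\<close>. Jacobi's imaginary transformation turns such a value, at
  \<open>q = e\<^sup>-\<^sup>\<epsilon>\<close>, into an elementary factor \<open>2 sin (\<pi> a / 13)\<close> times an exponential, times an infinite
  product in the dual nome \<open>exp (- 4 \<pi>\<^sup>2 / (13 \<epsilon>))\<close>. That last product is \<open>1\<close> up to a multiple of the dual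
  nome, which is the error term of the theorem. In this way the expansion is an exact formula
  (\<open>P_exact\<close>) for every \<open>\<epsilon> > 0\<close>, for each of the three products separately.

  The transformation (\<open>theta_transformation\<close>) is obtained from Liouville's theorem. Both sides, as
  functions of the elliptic variable, have the same quasi-periods and vanish to first order exactly on
  the same lattice, so their quotient is a constant \<open>C\<close>. Multiplying the values at the three half
  periods, Euler's identity \<open>\<Prod> (1 - q\<^sup>2\<^sup>n\<^sup>+\<^sup>1) (1 + q\<^sup>n\<^sup>+\<^sup>1) = 1\<close> makes each side collapse to the number
  \<open>2\<close>, which determines \<open>C\<^sup>3\<close>; the sign of \<open>C / \<i>\<close>, read off at one real half period, selects the
  cube root.

  It remains to recognize the constants: \<open>1 / (4 sin (\<pi> / 13) sin (5 \<pi> / 13)) = \<alpha> / \<surd>13\<close> and its two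
  analogues say that the quadratic Gauss sum modulo 13, whose value is \<open>\<surd>13\<close>, factors into a
  difference of cubic periods and a product of sines (\<open>gauss13_factorizations\<close>).
\<close>

section \<open>The infinite q-Pochhammer symbol\<close>

definition qpoch :: "complex \<Rightarrow> complex \<Rightarrow> complex" where
  "qpoch z q = (\<Prod>n. 1 - z * q ^ n)"

lemma convergent_prod_qpoch:
  fixes z q :: complex
  assumes "norm q < 1"
  shows "convergent_prod (\<lambda>n. 1 - z * q ^ n)"
proof -
  have "summable (\<lambda>n. norm z * norm q ^ n)"
    using assms by (intro summable_mult summable_geometric) auto
  then have "abs_convergent_prod (\<lambda>n. 1 - z * q ^ n)"
    by (simp add: abs_convergent_prod_conv_summable norm_mult norm_power)
  then show ?thesis
    by (rule abs_convergent_prod_imp_convergent_prod)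
qed

lemma qpoch_LIMSEQ:
  assumes "norm q < 1"
  shows "(\<lambda>N. \<Prod>n<N. 1 - z * q ^ n) \<longlonglongrightarrow> qpoch z q"
  unfolding qpoch_def
  by (intro has_prod_imp_tendsto' convergent_prod_has_prod convergent_prod_qpoch assms)

lemma qpoch_eq_0_iff:
  assumes "norm q < 1"
  shows "qpoch z q = 0 \<longleftrightarrow> (\<exists>n. z * q ^ n = 1)"
proof -
  have "(\<lambda>n. 1 - z * q ^ n) has_prod qpoch z q"
    unfolding qpoch_def by (intro convergent_prod_has_prod convergent_prod_qpoch assms)
  from has_prod_eq_0_iff[OF this] show ?thesis
    by (auto simp: image_iff)
qed

lemma qpoch_rec:
  assumes "norm q < 1"
  shows "qpoch z q = (1 - z) * qpoch (z * q) q"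
proof -
  have "(\<lambda>N. \<Prod>n<Suc N. 1 - z * q ^ n) \<longlonglongrightarrow> qpoch z q"
    using qpoch_LIMSEQ[OF assms] by (rule LIMSEQ_Suc)
  moreover have "(\<Prod>n<Suc N. 1 - z * q ^ n) = (1 - z) * (\<Prod>n<N. 1 - (z * q) * q ^ n)" for N
    by (simp only: prod.lessThan_Suc_shift o_def power_0 mult_1_right power_Suc mult.assoc)
  moreover have "(\<lambda>N. (1 - z) * (\<Prod>n<N. 1 - (z * q) * q ^ n)) \<longlonglongrightarrow> (1 - z) * qpoch (z * q) q"
    by (intro tendsto_intros qpoch_LIMSEQ assms)
  ultimately show ?thesis
    by (simp add: LIMSEQ_unique)
qed

lemma qpoch_mult_minus:
  assumes "norm q < 1"
  shows "qpoch z q * qpoch (- z) q = qpoch (z\<^sup>2) (q\<^sup>2)"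
proof -
  have "norm (q\<^sup>2) < 1"
    using assms by (simp add: norm_power power_less_one_iff)
  then have "(\<lambda>N. \<Prod>n<N. 1 - z\<^sup>2 * (q\<^sup>2) ^ n) \<longlonglongrightarrow> qpoch (z\<^sup>2) (q\<^sup>2)"
    by (rule qpoch_LIMSEQ)
  moreover have "(\<Prod>n<N. 1 - z\<^sup>2 * (q\<^sup>2) ^ n) = (\<Prod>n<N. 1 - z * q ^ n) * (\<Prod>n<N. 1 - (- z) * q ^ n)" for N
    unfolding prod.distrib[symmetric]
    by (intro prod.cong refl) (simp add: algebra_simps power2_eq_square power_mult_distrib)
  moreover have "(\<lambda>N. (\<Prod>n<N. 1 - z * q ^ n) * (\<Prod>n<N. 1 - (- z) * q ^ n)) \<longlonglongrightarrow> qpoch z q * qpoch (- z) q"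
    by (intro tendsto_mult qpoch_LIMSEQ assms)
  ultimately show ?thesis
    by (simp add: LIMSEQ_unique)
qed

lemma qpoch_even_odd:
  assumes "norm q < 1"
  shows "qpoch z q = qpoch z (q\<^sup>2) * qpoch (z * q) (q\<^sup>2)"
proof -
  have q2: "norm (q\<^sup>2) < 1"
    using assms by (simp add: norm_power power_less_one_iff)
  have "(\<Prod>n<2*N. 1 - z * q ^ n) = (\<Prod>n<N. 1 - z * (q\<^sup>2) ^ n) * (\<Prod>n<N. 1 - (z * q) * (q\<^sup>2) ^ n)" for N
    by (induction N) (simp_all add: algebra_simps flip: power_mult)
  moreover have "(\<lambda>N. \<Prod>n<2*N. 1 - z * q ^ n) \<longlonglongrightarrow> qpoch z q"
    using LIMSEQ_subseq_LIMSEQ[OF qpoch_LIMSEQ[OF assms, of z], of "\<lambda>N. 2 * N"]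
    by (simp add: strict_mono_def o_def)
  moreover have "(\<lambda>N. (\<Prod>n<N. 1 - z * (q\<^sup>2) ^ n) * (\<Prod>n<N. 1 - (z * q) * (q\<^sup>2) ^ n))
      \<longlonglongrightarrow> qpoch z (q\<^sup>2) * qpoch (z * q) (q\<^sup>2)"
    by (intro tendsto_mult qpoch_LIMSEQ q2)
  ultimately show ?thesis
    by (simp add: LIMSEQ_unique)
qed

lemma qpoch_nonzero:
  assumes "norm q < 1" "norm z < 1"
  shows "qpoch z q \<noteq> 0"
proof
  assume "qpoch z q = 0"
  then obtain n where "z * q ^ n = 1"
    using assms by (auto simp: qpoch_eq_0_iff)
  then have "norm z * norm q ^ n = 1"
    by (metis norm_mult norm_one norm_power)
  moreover have "norm z * norm q ^ n \<le> norm z * 1"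
    using assms by (intro mult_left_mono power_le_one) auto
  ultimately show False
    using assms by simp
qed

text \<open>Split \<open>(q; q)\<close> into the factors with odd and with even exponents, and split \<open>(q\<^sup>2; q\<^sup>2)\<close> by the
  difference of two squares; the common factor \<open>(q\<^sup>2; q\<^sup>2)\<close> then cancels.\<close>
lemma qpoch_Euler:
  assumes "norm q < 1"
  shows "qpoch q (q\<^sup>2) * qpoch (- q) q = 1"
proof -
  have q2: "norm (q\<^sup>2) < 1"
    using assms by (simp add: norm_power power_less_one_iff)
  have nome_nonzero: "qpoch (q\<^sup>2) (q\<^sup>2) \<noteq> 0"
    by (intro qpoch_nonzero q2)
  have "qpoch (q\<^sup>2) (q\<^sup>2) = qpoch q q * qpoch (- q) q"
    using qpoch_mult_minus[OF assms, of q] by simp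
  also have "qpoch q q = qpoch q (q\<^sup>2) * qpoch (q\<^sup>2) (q\<^sup>2)"
    using qpoch_even_odd[OF assms, of q] by (simp add: power2_eq_square)
  finally have "qpoch (q\<^sup>2) (q\<^sup>2) * (qpoch q (q\<^sup>2) * qpoch (- q) q) = qpoch (q\<^sup>2) (q\<^sup>2) * 1"
    by (simp add: mult_ac)
  with nome_nonzero show ?thesis
    by (metis mult_cancel_left)
qed

lemma qpoch_in_Reals:
  assumes "z \<in> \<real>" "q \<in> \<real>" "norm q < 1"
  shows "qpoch z q \<in> \<real>"
proof (rule Lim_in_closed_set[OF closed_complex_Reals _ _ qpoch_LIMSEQ[OF assms(3)]])
  show "\<forall>\<^sub>F N in sequentially. (\<Prod>n<N. 1 - z * q ^ n) \<in> \<real>"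
    using assms by (intro always_eventually allI prod_in_Reals) auto
qed auto

text \<open>A bound that is linear in \<open>z\<close> near \<open>0\<close>; with \<open>z\<close> of modulus \<open>norm q\<close> it produces the error term of
  the asymptotics.\<close>
lemma norm_qpoch_minus_1_le:
  assumes "norm q < 1"
  shows "norm (qpoch z q - 1) \<le> exp (norm z / (1 - norm q)) - 1"
proof (rule tendsto_upperbound)
  show "(\<lambda>N. norm ((\<Prod>n<N. 1 - z * q ^ n) - 1)) \<longlonglongrightarrow> norm (qpoch z q - 1)"
    by (intro tendsto_intros qpoch_LIMSEQ assms)
  show "\<forall>\<^sub>F N in sequentially. norm ((\<Prod>n<N. 1 - z * q ^ n) - 1) \<le> exp (norm z / (1 - norm q)) - 1"
  proof (intro always_eventually allI)
    fix N
    have "norm ((\<Prod>n<N. 1 + (- z * q ^ n)) - 1) \<le> (\<Prod>n<N. 1 + norm (- z * q ^ n)) - 1"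
      by (rule norm_prod_minus1_le_prod_minus1)
    also have "(\<Prod>n<N. 1 + norm (- z * q ^ n)) \<le> exp (\<Sum>n<N. norm (- z * q ^ n))"
      by (rule prod_le_exp_sum) auto
    also have "(\<Sum>n<N. norm (- z * q ^ n)) = norm z * (\<Sum>n<N. norm q ^ n)"
      by (simp add: norm_mult norm_power sum_distrib_left)
    also have "(\<Sum>n<N. norm q ^ n) \<le> (\<Sum>n. norm q ^ n)"
      using assms by (intro sum_le_suminf summable_geometric) auto
    also have "(\<Sum>n. norm q ^ n) = 1 / (1 - norm q)"
      using assms by (intro suminf_geometric) auto
    finally show "norm ((\<Prod>n<N. 1 - z * q ^ n) - 1) \<le> exp (norm z / (1 - norm q)) - 1"
      by (simp add: mult_left_mono)
  qed
qed auto

lemma holomorphic_qpoch: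
  assumes "norm q < 1"
  shows "(\<lambda>z. qpoch z q) holomorphic_on UNIV"
proof (rule holomorphic_uniform_sequence)
  fix x :: complex
  let ?P = "\<lambda>N z. \<Prod>n<N. 1 - z * q ^ n"
  have "uniformly_convergent_on (cball x 1) (\<lambda>N z. \<Sum>n<N. norm ((1 - z * q ^ n) - 1))"
  proof (rule Weierstrass_m_test')
    fix n z assume "z \<in> cball x 1"
    then have "norm z \<le> norm x + 1"
      using norm_triangle_ineq2[of z x] by (simp add: dist_norm norm_minus_commute)
    then show "norm (norm ((1 - z * q ^ n) - 1)) \<le> (norm x + 1) * norm q ^ n"
      by (simp add: norm_mult norm_power mult_right_mono)
  next
    show "summable (\<lambda>n. (norm x + 1) * norm q ^ n)"
      using assms by (intro summable_mult summable_geometric) auto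
  qed
  then have "uniformly_convergent_on (cball x 1) ?P"
    by (intro uniformly_convergent_on_prod') (auto intro!: continuous_intros)
  then obtain g where g: "uniform_limit (cball x 1) ?P g sequentially"
    by (auto simp: uniformly_convergent_on_def)
  have "g z = qpoch z q" if "z \<in> cball x 1" for z
    using tendsto_uniform_limitI[OF g that] qpoch_LIMSEQ[OF assms] LIMSEQ_unique by blast
  then have "uniform_limit (cball x 1) ?P g sequentially
      \<longleftrightarrow> uniform_limit (cball x 1) ?P (\<lambda>z. qpoch z q) sequentially"
    by (intro uniform_limit_cong') auto
  with g have "uniform_limit (cball x 1) ?P (\<lambda>z. qpoch z q) sequentially"
    by simp
  then show "\<exists>d>0. cball x d \<subseteq> UNIV \<and> uniform_limit (cball x d) ?P (\<lambda>z. qpoch z q) sequentially"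
    by (intro exI[of _ 1]) auto
qed (auto intro!: holomorphic_intros)

lemma holomorphic_on_qpoch [holomorphic_intros]:
  assumes "f holomorphic_on S" "norm q < 1"
  shows "(\<lambda>w. qpoch (f w) q) holomorphic_on S"
  using holomorphic_on_compose[OF assms(1) holomorphic_on_subset[OF holomorphic_qpoch[OF assms(2)]]]
  by (simp add: o_def)

section \<open>The theta function and its half periods\<close>

definition theta :: "complex \<Rightarrow> complex \<Rightarrow> complex" where
  "theta w q = qpoch w q * qpoch (q / w) q"

lemma theta_shift:
  assumes "norm q < 1" "q \<noteq> 0" "w \<noteq> 0"
  shows "theta (w * q) q = - theta w q / w"
proof -
  have "theta (w * q) q = qpoch (w * q) q * qpoch (1 / w) q"
    using assms by (simp add: theta_def)
  also have "qpoch (1 / w) q = (1 - 1 / w) * qpoch (q / w) q"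
    using qpoch_rec[OF assms(1), of "1 / w"] by simp
  also have "qpoch (w * q) q * ((1 - 1 / w) * qpoch (q / w) q) =
      - ((1 - w) * qpoch (w * q) q * qpoch (q / w) q) / w"
    using assms by (simp add: field_simps)
  also have "(1 - w) * qpoch (w * q) q = qpoch w q"
    by (rule qpoch_rec[symmetric]) fact
  finally show ?thesis
    by (simp add: theta_def)
qed

lemma theta_eq_0_imp:
  assumes "norm q < 1" "q \<noteq> 0" "w \<noteq> 0" "theta w q = 0"
  shows "\<exists>n::int. w = q powi n"
proof -
  from assms(4) consider n where "w * q ^ n = 1" | n where "q / w * q ^ n = 1"
    by (auto simp: theta_def qpoch_eq_0_iff[OF assms(1)])
  then show ?thesis
  proof cases
    case 1
    then have "w = q powi (- int n)"
      using assms by (simp add: power_int_minus field_simps)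
    then show ?thesis ..
  next
    case 2
    then have "w = q ^ Suc n"
      using assms by (simp add: field_simps)
    then have "w = q powi int (Suc n)"
      by (simp only: power_int_of_nat)
    then show ?thesis ..
  qed
qed

text \<open>The product of the theta values at the three nontrivial 2-torsion points \<open>\<plusminus>r\<close>, \<open>-1\<close> is the same
  number for every nome. This is what fixes the constant in the transformation law.\<close>
lemma theta_half_periods:
  assumes "norm r < 1" "r \<noteq> 0"
  shows "theta r (r\<^sup>2) * theta (- 1) (r\<^sup>2) * theta (- r) (r\<^sup>2) = 2"
proof -
  have q: "norm (r\<^sup>2) < 1"
    using assms by (simp add: norm_power power_less_one_iff)
  have "theta r (r\<^sup>2) = (qpoch r (r\<^sup>2))\<^sup>2" "theta (- r) (r\<^sup>2) = (qpoch (- r) (r\<^sup>2))\<^sup>2"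
    using assms by (simp_all add: theta_def power2_eq_square)
  moreover have "theta (- 1) (r\<^sup>2) = 2 * (qpoch (- r\<^sup>2) (r\<^sup>2))\<^sup>2"
    using qpoch_rec[OF q, of "- 1"] by (simp add: theta_def power2_eq_square)
  moreover have "qpoch (- r) r = qpoch (- r) (r\<^sup>2) * qpoch (- r\<^sup>2) (r\<^sup>2)"
    using qpoch_even_odd[OF assms(1), of "- r"] by (simp add: power2_eq_square)
  ultimately have "theta r (r\<^sup>2) * theta (- 1) (r\<^sup>2) * theta (- r) (r\<^sup>2)
      = 2 * (qpoch r (r\<^sup>2) * qpoch (- r) r)\<^sup>2"
    by (simp add: power_mult_distrib)
  then show ?thesis
    by (simp add: qpoch_Euler[OF assms(1)])
qed

lemma qpoch_real_square_pos:
  assumes "z \<in> \<real>" "q \<in> \<real>" "norm q < 1" "qpoch z q \<noteq> 0"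
  shows "\<exists>p>0. (qpoch z q)\<^sup>2 = of_real p"
proof -
  obtain x where "qpoch z q = of_real x"
    using qpoch_in_Reals[OF assms(1-3)] by (auto elim: Reals_cases)
  with assms(4) show ?thesis
    by (intro exI[of _ "x\<^sup>2"]) auto
qed

definition lattice :: "real \<Rightarrow> complex set" where
  "lattice t = {l. \<exists>m n :: int. l = of_int m + of_int n * (\<i> * t)}"

text \<open>The codomain is arbitrary so that the rule also applies to properties such as the vanishing of a
  function that is periodic only up to a nonzero factor.\<close>
lemma lattice_periodic:
  assumes "\<And>u. f (u + 1) = f u" "\<And>u. f (u + \<i> * t) = f u" "l \<in> lattice t"
  shows "f (u + l) = (f u :: 'a)"
proof -
  have iter: "f (u + of_int k * p) = f u" if p: "\<And>u. f (u + p) = f u" for k u and p :: complex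
  proof (induction k rule: int_induct[where k = 0])
    case (step1 i)
    have "f (u + of_int (i + 1) * p) = f ((u + of_int i * p) + p)"
      by (simp add: algebra_simps)
    with step1 show ?case by (simp only: p)
  next
    case (step2 i)
    have "f (u + of_int (i - 1) * p) = f ((u + of_int (i - 1) * p) + p)"
      by (simp only: p)
    also have "\<dots> = f (u + of_int i * p)"
      by (simp add: algebra_simps)
    finally show ?case using step2 by simp
  qed simp
  from assms(3) obtain m n :: int where l: "l = of_int m + of_int n * (\<i> * t)"
    by (auto simp: lattice_def)
  have "f (u + l) = f ((u + of_int m * 1) + of_int n * (\<i> * t))"
    by (simp add: l add.assoc)
  also have "\<dots> = f u"
    using iter[OF assms(2), of "u + of_int m * 1" n] iter[OF assms(1), of u m] by simp
  finally show ?thesis .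
qed

lemma exp_half_pi_i: "exp (of_real pi / 2 * \<i>) = \<i>"
  using cis_pi_half by (simp add: cis_conv_exp mult.commute)

lemma lattice_uminus: "l \<in> lattice t \<Longrightarrow> - l \<in> lattice t"
  unfolding lattice_def
proof safe
  fix m n :: int
  show "\<exists>m' n' :: int. - (of_int m + of_int n * (\<i> * t)) = of_int m' + of_int n' * (\<i> * of_real t)"
    by (intro exI[of _ "- m"] exI[of _ "- n"]) simp
qed

text \<open>The values of a doubly periodic function are all taken on one period parallelogram, which is
  compact, so Liouville's theorem applies.\<close>
lemma elliptic_entire_constant:
  assumes t: "t > 0" and hol: "f holomorphic_on UNIV"
    and per: "\<And>u. f (u + 1) = f u" "\<And>u. f (u + \<i> * complex_of_real t) = f u"
  shows "\<exists>c. \<forall>u. f u = c"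
proof -
  let ?g = "\<lambda>p. complex_of_real (fst p) + of_real (snd p) * (\<i> * t)"
  let ?K = "f ` ?g ` ({0..1} \<times> {0..1})"
  have "continuous_on UNIV f"
    using hol by (rule holomorphic_on_imp_continuous_on)
  then have "continuous_on S f" for S
    by (rule continuous_on_subset) simp
  moreover have "continuous_on S ?g" for S
    by (intro continuous_intros)
  ultimately have compact: "compact ?K"
    by (intro compact_continuous_image compact_Times compact_Icc)
  have "range f \<subseteq> ?K"
  proof (rule image_subsetI)
    fix u :: complex
    let ?x = "frac (Re u)" and ?y = "frac (Im u / t)"
    define l where "l = of_int \<lfloor>Re u\<rfloor> + of_int \<lfloor>Im u / t\<rfloor> * (\<i> * complex_of_real t)"
    have u: "u = ?g (?x, ?y) + l"
    proof (rule complex_eqI)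
      have "Im u = (Im u / t) * t"
        using t by simp
      also have "Im u / t = ?y + of_int \<lfloor>Im u / t\<rfloor>"
        by (simp add: frac_def)
      finally show "Im u = Im (?g (?x, ?y) + l)"
        by (simp add: l_def distrib_right)
    qed (simp add: l_def frac_def)
    have "l \<in> lattice t"
      unfolding lattice_def l_def by blast
    then have "f (?g (?x, ?y) + l) = f (?g (?x, ?y))"
      by (rule lattice_periodic[of f t, OF per])
    with arg_cong[OF u, of f] have fu: "f u = f (?g (?x, ?y))"
      by (rule trans)
    have "(?x, ?y) \<in> {0..1} \<times> {0..1}"
      using frac_lt_1[of "Re u"] frac_lt_1[of "Im u / t"] by (simp add: less_eq_real_def)
    then show "f u \<in> ?K"
      unfolding fu by (intro imageI)
  qed
  then have "bounded (range f)"
    by (rule bounded_subset[OF compact_imp_bounded[OF compact]])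
  from Liouville_theorem[OF hol this] show ?thesis
    by (simp add: constant_on_def)
qed

lemma exp_minus_1_over_tendsto: "((\<lambda>u::complex. (1 - exp (a * u)) / u) \<longlongrightarrow> - a) (at 0)"
proof -
  have "((\<lambda>u. exp (a * u)) has_field_derivative a) (at 0)"
    by (auto intro!: derivative_eq_intros)
  then have "((\<lambda>u. (exp (a * u) - 1) / u) \<longlongrightarrow> a) (at 0)"
    by (simp add: has_field_derivative_iff)
  from tendsto_minus[OF this] show ?thesis
    by (simp add: diff_divide_distrib)
qed

section \<open>The imaginary transformation of the theta function\<close>

context
  fixes t :: real
  assumes t: "t > 0"
begin

text \<open>In this section \<open>\<tau> = \<i> / t\<close> and the variable \<open>u\<close> is the elliptic variable divided by \<open>\<tau>\<close>.
  With this scaling \<open>theta_side\<close> and \<open>dual_side\<close> share the quasi-periods \<open>1\<close> and \<open>\<i> t\<close>; the quadratic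
  exponential \<open>gaussian\<close> is the one that makes the two automorphy factors equal.\<close>
definition "nome = exp (- 2 * complex_of_real pi / t)"
definition "dual_nome = exp (- 2 * complex_of_real pi * t)"
definition "coord u = exp (- 2 * complex_of_real pi / t * u)"
definition "dual_coord u = exp (2 * complex_of_real pi * \<i> * u)"
definition "gaussian u = exp (complex_of_real pi / t * u\<^sup>2 - (complex_of_real pi / t + complex_of_real pi * \<i>) * u)"
definition "theta_side u = theta (coord u) nome"
definition "dual_side u = gaussian u * theta (dual_coord u) dual_nome"

lemma norm_nome: "norm nome < 1" and norm_dual_nome: "norm dual_nome < 1"
  using t by (simp_all add: nome_def dual_nome_def)

lemma nome_nonzero [simp]: "nome \<noteq> 0" "dual_nome \<noteq> 0" "coord u \<noteq> 0" "dual_coord u \<noteq> 0" "gaussian u \<noteq> 0"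
  by (simp_all add: nome_def dual_nome_def coord_def dual_coord_def gaussian_def)

lemma theta_side_plus_1: "theta_side (u + 1) = - theta_side u / coord u"
proof -
  have "coord (u + 1) = coord u * nome"
    by (simp only: coord_def nome_def distrib_left exp_add mult_1_right)
  then show ?thesis
    by (simp add: theta_side_def theta_shift norm_nome)
qed

lemma theta_side_plus_it: "theta_side (u + \<i> * t) = theta_side u"
proof -
  have "coord (u + \<i> * t) = exp (- 2 * complex_of_real pi / t * u - 2 * pi * \<i>)"
    using t unfolding coord_def by (intro arg_cong[of _ _ exp]) (simp add: field_simps)
  then have "coord (u + \<i> * t) = coord u"
    by (simp add: exp_diff coord_def)
  then show ?thesis
    by (simp add: theta_side_def)
qed

lemma exp_minus_pi_i: "exp (x - complex_of_real pi * \<i>) = - exp x"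
  by (simp add: exp_diff)

lemma dual_side_plus_1: "dual_side (u + 1) = - dual_side u / coord u"
proof -
  have "dual_coord (u + 1) = dual_coord u"
    by (simp add: dual_coord_def distrib_left exp_add)
  moreover have "gaussian (u + 1) = - (gaussian u / coord u)"
  proof -
    have "a * (u + 1)\<^sup>2 - (a + b) * (u + 1) = a * u\<^sup>2 - (a + b) * u - (- 2 * a * u) - b" for a b :: complex
      by algebra
    from this[of "complex_of_real pi / t" "complex_of_real pi * \<i>"] show ?thesis
      unfolding gaussian_def coord_def exp_minus_pi_i[symmetric] exp_diff[symmetric] by simp
  qed
  ultimately show ?thesis
    by (simp add: dual_side_def)
qed

lemma dual_side_plus_it: "dual_side (u + \<i> * t) = dual_side u"
proof -
  have "dual_coord (u + \<i> * t) = dual_coord u * dual_nome"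
    unfolding dual_coord_def dual_nome_def exp_add[symmetric]
    by (intro arg_cong[of _ _ exp]) (simp add: algebra_simps)
  then have "theta (dual_coord (u + \<i> * t)) dual_nome = - theta (dual_coord u) dual_nome / dual_coord u"
    by (simp add: theta_shift norm_dual_nome)
  moreover have "gaussian (u + \<i> * t) = - (gaussian u * dual_coord u)"
  proof -
    have "a * (u + i * s)\<^sup>2 - (a + p * i) * (u + i * s) = a * u\<^sup>2 - (a + p * i) * u + 2 * p * i * u - p * i"
      if "p = a * s" for a p s i :: complex
      unfolding that by algebra
    from this[of "complex_of_real pi" "complex_of_real pi / t" t "\<i>"] show ?thesis
      using t unfolding gaussian_def dual_coord_def exp_minus_pi_i[symmetric] exp_add[symmetric] by simp
  qed
  ultimately show ?thesis
    by (simp add: dual_side_def)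
qed

lemma dual_side_eq_0_imp:
  assumes "dual_side u = 0"
  shows "u \<in> lattice t"
proof -
  have "theta (dual_coord u) dual_nome = 0"
    using assms by (simp add: dual_side_def)
  then obtain n where "dual_coord u = dual_nome powi n"
    using theta_eq_0_imp[of dual_nome "dual_coord u"] norm_dual_nome by auto
  then have "exp (2 * complex_of_real pi * \<i> * u) = exp (of_int n * (- 2 * complex_of_real pi * t))"
    by (simp add: dual_coord_def dual_nome_def exp_power_int)
  then obtain m :: int where
    "2 * complex_of_real pi * \<i> * u = of_int n * (- 2 * complex_of_real pi * t) + (of_int (2 * m) * pi) * \<i>"
    by (auto simp: exp_eq)
  also have "\<dots> = 2 * complex_of_real pi * \<i> * (of_int m + of_int n * (\<i> * t))"
    by (simp add: algebra_simps)
  finally have "u = of_int m + of_int n * (\<i> * t)"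
    by (subst (asm) mult_cancel_left) simp
  then show ?thesis
    unfolding lattice_def by (intro CollectI exI)
qed

text \<open>The cofactors remain when the simple zero at \<open>u = 0\<close> is split off.\<close>
definition "theta_cofactor u = qpoch (coord u * nome) nome * qpoch (nome / coord u) nome"
definition "dual_cofactor u =
  gaussian u * (qpoch (dual_coord u * dual_nome) dual_nome * qpoch (dual_nome / dual_coord u) dual_nome)"

lemma theta_side_eq: "theta_side u = (1 - coord u) * theta_cofactor u"
  unfolding theta_side_def theta_cofactor_def theta_def by (subst qpoch_rec[OF norm_nome]) (simp add: mult_ac)

lemma dual_side_eq: "dual_side u = (1 - dual_coord u) * dual_cofactor u"
  unfolding dual_side_def dual_cofactor_def theta_def by (subst qpoch_rec[OF norm_dual_nome]) (simp add: mult_ac)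

lemma dual_cofactor_0: "dual_cofactor 0 \<noteq> 0"
  using norm_dual_nome by (simp add: dual_cofactor_def dual_coord_def qpoch_nonzero)

lemma holomorphic_sides:
  "theta_side holomorphic_on S" "dual_side holomorphic_on S"
  "theta_cofactor holomorphic_on S" "dual_cofactor holomorphic_on S"
  unfolding theta_side_def dual_side_def theta_cofactor_def dual_cofactor_def theta_def
    coord_def dual_coord_def gaussian_def
  by (intro holomorphic_intros norm_nome norm_dual_nome exp_not_eq_zero)+

text \<open>The value assigned on the lattice is the limit of the quotient at \<open>0\<close>: the zeros contribute
  \<open>(2 \<pi> / t) / (- 2 \<pi> \<i>) = \<i> / t\<close>.\<close>
definition "ratio_at_lattice = \<i> / t * theta_cofactor 0 / dual_cofactor 0"
definition "ratio u = (if dual_side u = 0 then ratio_at_lattice else theta_side u / dual_side u)"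

lemma ratio_plus_1: "ratio (u + 1) = ratio u"
  by (simp add: ratio_def theta_side_plus_1 dual_side_plus_1)

lemma ratio_plus_it: "ratio (u + \<i> * t) = ratio u"
  by (simp add: ratio_def theta_side_plus_it dual_side_plus_it)

lemma dual_side_nonzero_near_0: "\<exists>r>0. \<forall>u\<in>ball 0 r - {0}. dual_side u \<noteq> 0"
proof -
  have "isCont dual_cofactor 0"
    using holomorphic_sides(4)[of UNIV] by (auto dest!: holomorphic_on_imp_continuous_on simp: continuous_on_eq_continuous_at)
  then obtain e where e: "e > 0" "\<And>u. dist 0 u < e \<Longrightarrow> dual_cofactor u \<noteq> 0"
    using continuous_at_avoid[of 0 dual_cofactor 0] dual_cofactor_0 by blast
  have "dual_coord u \<noteq> 1" if "norm u < 1" "u \<noteq> 0" for u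
  proof
    assume "dual_coord u = 1"
    then obtain n :: int where n: "Re (2 * complex_of_real pi * \<i> * u) = 0" 
      "Im (2 * complex_of_real pi * \<i> * u) = of_int (2 * n) * pi"
      unfolding dual_coord_def exp_eq_1 by blast
    then have "Im u = 0" "Re u = of_int n"
      by auto
    with that show False
      by (auto simp: cmod_def complex_eq_iff)
  qed
  with e show ?thesis
    by (intro exI[of _ "min e 1"]) (auto simp: dual_side_eq)
qed

text \<open>Away from the lattice the quotient is holomorphic. At \<open>0\<close> the two simple zeros cancel, so the
  singularity is removable, and periodicity carries this to every other lattice point.\<close>
lemma ratio_holomorphic: "ratio holomorphic_on UNIV"
proof -
  have zero: "ratio field_differentiable at 0"
  proof -
    obtain r where r: "r > 0" "\<And>u. u \<in> ball 0 r - {0} \<Longrightarrow> dual_side u \<noteq> 0"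
      using dual_side_nonzero_near_0 by blast
    have lim: "(ratio \<longlongrightarrow> ratio 0) (at 0)"
    proof -
      have "((\<lambda>u. (((1 - exp (- 2 * complex_of_real pi / t * u)) / u) / ((1 - exp (2 * complex_of_real pi * \<i> * u)) / u))
          * (theta_cofactor u / dual_cofactor u)) \<longlongrightarrow>
          ((- (- 2 * complex_of_real pi / t)) / (- (2 * complex_of_real pi * \<i>))) * (theta_cofactor 0 / dual_cofactor 0)) (at 0)"
        using holomorphic_sides(3,4)[of UNIV] dual_cofactor_0
        by (intro tendsto_mult tendsto_divide exp_minus_1_over_tendsto)
           (auto dest!: holomorphic_on_imp_continuous_on simp: continuous_on_eq_continuous_at isCont_def)
      also have "((- (- 2 * complex_of_real pi / t)) / (- (2 * complex_of_real pi * \<i>))) * (theta_cofactor 0 / dual_cofactor 0) = ratio 0"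
        using t dual_cofactor_0 by (simp add: ratio_def dual_side_eq ratio_at_lattice_def dual_coord_def divide_simps)
      finally show ?thesis
      proof (rule Lim_transform_eventually)
        have "\<forall>\<^sub>F u in at 0. u \<in> ball 0 r - {0}"
          using r(1) by (intro eventually_at_in_open) auto
        then show "\<forall>\<^sub>F u in at 0. ((1 - exp (- 2 * complex_of_real pi / t * u)) / u) / ((1 - exp (2 * complex_of_real pi * \<i> * u)) / u)
          * (theta_cofactor u / dual_cofactor u) = ratio u"
        proof eventually_elim
          case (elim u)
          then show ?case
            using r(2)[OF elim] by (simp add: ratio_def theta_side_eq dual_side_eq coord_def dual_coord_def)
        qed
      qed
    qed
    have "ratio holomorphic_on ball 0 r"
    proof (rule no_isolated_singularity'[of "{0}"])
      show "(ratio \<longlongrightarrow> ratio z) (at z within ball 0 r)" if "z \<in> {0}" for z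
        using that lim by (auto intro: tendsto_within_subset)
      have "(\<lambda>u. theta_side u / dual_side u) holomorphic_on (ball 0 r - {0})"
        using r(2) by (intro holomorphic_intros holomorphic_sides) auto
      then show "ratio holomorphic_on (ball 0 r - {0})"
        by (rule holomorphic_transform) (use r(2) in \<open>auto simp: ratio_def\<close>)
    qed auto
    then show ?thesis
      using r(1) by (intro holomorphic_on_imp_differentiable_at[of _ "ball 0 r"]) auto
  qed
  have "ratio field_differentiable at z" for z
  proof (cases "dual_side z = 0")
    case True
    then have "- z \<in> lattice t"
      by (intro lattice_uminus dual_side_eq_0_imp)
    then have "ratio = ratio \<circ> (\<lambda>u. u + - z)"
      using lattice_periodic[of ratio t "- z", OF ratio_plus_1 ratio_plus_it] by (simp add: fun_eq_iff)
    moreover have "ratio \<circ> (\<lambda>u. u + - z) field_differentiable at z"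
      using zero by (intro field_differentiable_compose) (auto intro!: derivative_intros)
    ultimately show ?thesis
      by simp
  next
    case False
    let ?S = "{u. dual_side u \<noteq> 0}"
    have "open ?S"
      using holomorphic_sides(2)[of UNIV] by (intro open_Collect_neq) (auto intro: holomorphic_on_imp_continuous_on)
    moreover have "(\<lambda>u. theta_side u / dual_side u) holomorphic_on ?S"
      by (intro holomorphic_intros holomorphic_sides) auto
    then have "ratio holomorphic_on ?S"
      by (rule holomorphic_transform) (auto simp: ratio_def)
    ultimately show ?thesis
      using False by (intro holomorphic_on_imp_differentiable_at[of _ ?S]) auto
  qed
  then show ?thesis
    by (simp add: holomorphic_on_def)
qed

lemma theta_side_eq_const_dual_side: "\<exists>C. \<forall>u. theta_side u = C * dual_side u"
proof -
  from elliptic_entire_constant[of t ratio, OF t ratio_holomorphic ratio_plus_1 ratio_plus_it]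
  obtain C where C: "ratio u = C" for u
    by metis
  have "theta_side u = C * dual_side u" for u
  proof (cases "dual_side u = 0")
    case True
    have "(theta_side (v + 1) = 0) = (theta_side v = 0)" "(theta_side (v + \<i> * t) = 0) = (theta_side v = 0)" for v
      by (simp_all add: theta_side_plus_1 theta_side_plus_it)
    from lattice_periodic[where f = "\<lambda>v. theta_side v = 0", OF this dual_side_eq_0_imp[OF True], of 0]
    have "(theta_side u = 0) = (theta_side 0 = 0)"
      by simp
    then show ?thesis
      using True by (simp add: theta_side_eq coord_def)
  next
    case False
    then show ?thesis
      using C[of u] by (auto simp: ratio_def field_simps)
  qed
  then show ?thesis by blast
qed

text \<open>Write the constant as \<open>C = \<i> y\<close>. The point \<open>u = 1/2\<close> shows that \<open>y\<close> is a positive real, and the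
  product over the three half periods \<open>1/2\<close>, \<open>\<i> t / 2\<close>, \<open>1/2 + \<i> t / 2\<close> determines \<open>y ^ 3\<close>.\<close>
lemma theta_side_eq_dual_side: "theta_side u = \<i> * exp (pi / (6 * t) - pi * t / 6) * dual_side u"
proof -
  obtain C where C: "\<And>u. theta_side u = C * dual_side u"
    using theta_side_eq_const_dual_side by blast
  define r where "r = complex_of_real (exp (- pi / t))"
  define r' where "r' = complex_of_real (exp (- pi * t))"
  have r: "norm r < 1" "r \<noteq> 0" "r \<in> \<real>" and r': "norm r' < 1" "r' \<noteq> 0" "r' \<in> \<real>"
    using t by (simp_all add: r_def r'_def)
  have "nome = exp (of_real (2 * (- pi / t)))"
    by (simp add: nome_def)
  also have "\<dots> = r\<^sup>2"
    by (simp only: exp_of_real exp_double of_real_power r_def)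
  finally have nome: "nome = r\<^sup>2" .
  have "dual_nome = exp (of_real (2 * (- pi * t)))"
    by (simp add: dual_nome_def mult.assoc)
  also have "\<dots> = r'\<^sup>2"
    by (simp only: exp_of_real exp_double of_real_power r'_def)
  finally have dual_nome: "dual_nome = r'\<^sup>2" .
  have "coord (1/2) = exp (of_real (- pi / t))"
    unfolding coord_def by (intro arg_cong[of _ _ exp]) simp
  moreover have "dual_coord (1/2) = exp (of_real pi * \<i>)"
    unfolding dual_coord_def by (intro arg_cong[of _ _ exp]) simp
  ultimately have w1: "coord (1/2) = r" "dual_coord (1/2) = - 1"
    by (simp_all only: exp_pi_i r_def exp_of_real)
  have "coord (\<i> * t / 2) = exp (- (complex_of_real pi * \<i>))"
    using t unfolding coord_def by (intro arg_cong[of _ _ exp]) (simp add: field_simps)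
  moreover have "dual_coord (\<i> * t / 2) = exp (of_real (- pi * t))"
    unfolding dual_coord_def by (intro arg_cong[of _ _ exp]) (simp add: field_simps)
  ultimately have w2: "coord (\<i> * t / 2) = - 1" "dual_coord (\<i> * t / 2) = r'"
    by (simp_all only: exp_minus exp_pi_i r'_def exp_of_real) simp
  have "coord (u + v) = coord u * coord v" "dual_coord (u + v) = dual_coord u * dual_coord v" for u v
    by (simp_all only: coord_def dual_coord_def distrib_left exp_add)
  with w1 w2 have w3: "coord (1/2 + \<i> * t / 2) = - r" "dual_coord (1/2 + \<i> * t / 2) = - r'"
    by simp_all
  define y where "y = C / \<i>"
  have G1: "gaussian (1/2) = exp (- pi / (4 * t)) / \<i>"
  proof -
    have "gaussian (1/2) = exp (complex_of_real (- pi / (4 * t)) - of_real pi / 2 * \<i>)"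
      using t unfolding gaussian_def by (intro arg_cong[of _ _ exp]) (simp add: field_simps power2_eq_square)
    also have "\<dots> = exp (- pi / (4 * t)) / \<i>"
      by (simp only: exp_diff exp_half_pi_i exp_of_real)
    finally show ?thesis .
  qed
  have "\<exists>y'>0. y = complex_of_real y'"
  proof -
    have "qpoch r nome \<noteq> 0" "qpoch (- dual_nome) dual_nome \<noteq> 0"
      using norm_nome norm_dual_nome r by (simp_all add: qpoch_nonzero)
    then obtain p p' where p: "p > 0" "p' > 0" "(qpoch r nome)\<^sup>2 = of_real p" "(qpoch (- dual_nome) dual_nome)\<^sup>2 = of_real p'"
      using qpoch_real_square_pos[of r nome] qpoch_real_square_pos[of "- dual_nome" dual_nome] norm_nome norm_dual_nome r r' nome dual_nome
      by (auto simp del: of_real_power)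
    have "of_real p = theta_side (1/2)"
      using p(3) r nome by (simp add: theta_side_def w1 theta_def power2_eq_square)
    also have "\<dots> = C * (gaussian (1/2) * (2 * of_real p'))"
      using qpoch_rec[OF norm_dual_nome, of "- 1"] p(4) by (simp add: C dual_side_def w1 theta_def power2_eq_square)
    also have "\<dots> = y * of_real (2 * p' * exp (- pi / (4 * t)))"
      by (simp add: y_def G1)
    finally have "y = of_real (p / (2 * p' * exp (- pi / (4 * t))))"
      using p by (simp add: field_simps)
    then show ?thesis
      using p by (intro exI[of _ "p / (2 * p' * exp (- pi / (4 * t)))"]) auto
  qed
  moreover have "C = \<i> * y"
    by (simp add: y_def)
  ultimately obtain y' where y': "y' > 0" "C = \<i> * of_real y'"
    by blast
  have "gaussian (1/2) * gaussian (\<i> * t / 2) * gaussian (1/2 + \<i> * t / 2)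
      = exp (complex_of_real (pi * t / 2 - pi / (2 * t)) + of_real pi / 2 * \<i> - 2 * of_real pi * \<i>)"
    using t unfolding gaussian_def exp_add[symmetric]
    by (intro arg_cong[of _ _ exp]) (simp add: field_simps power2_eq_square)
  also have "\<dots> = exp (pi * t / 2 - pi / (2 * t)) * \<i>"
    by (simp only: exp_diff exp_add exp_half_pi_i exp_of_real exp_two_pi_i div_by_1)
  finally have G: "gaussian (1/2) * gaussian (\<i> * t / 2) * gaussian (1/2 + \<i> * t / 2) = exp (pi * t / 2 - pi / (2 * t)) * \<i>" .
  \<comment> \<open>Both theta products over the half periods equal 2, so only \<open>C ^ 3\<close> and the exponentials survive.\<close>
  have "2 = theta_side (1/2) * theta_side (\<i> * t / 2) * theta_side (1/2 + \<i> * t / 2)"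
    using theta_half_periods[OF r(1,2)] by (simp add: theta_side_def w1 w2 w3 nome mult_ac)
  also have "\<dots> = C ^ 3 * (gaussian (1/2) * gaussian (\<i> * t / 2) * gaussian (1/2 + \<i> * t / 2)) *
      (theta (- 1) (r'\<^sup>2) * theta r' (r'\<^sup>2) * theta (- r') (r'\<^sup>2))"
    by (simp add: C dual_side_def w1 w2 w3 dual_nome power3_eq_cube)
  also have "theta (- 1) (r'\<^sup>2) * theta r' (r'\<^sup>2) * theta (- r') (r'\<^sup>2) = 2"
    using theta_half_periods[OF r'(1,2)] by (simp add: mult_ac)
  also have "C ^ 3 * (gaussian (1/2) * gaussian (\<i> * t / 2) * gaussian (1/2 + \<i> * t / 2)) * 2
      = of_real (2 * y' ^ 3 * exp (pi * t / 2 - pi / (2 * t)))"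
  proof -
    have "(\<i> * complex_of_real a) ^ 3 * (of_real b * \<i>) * 2 = of_real (2 * a ^ 3 * b)" for a b
      by (simp add: power_mult_distrib power3_eq_cube)
    then show ?thesis
      unfolding G y'(2) .
  qed
  finally have "complex_of_real 2 = of_real (2 * y' ^ 3 * exp (pi * t / 2 - pi / (2 * t)))"
    by simp
  then have "1 = y' ^ 3 * exp (pi * t / 2 - pi / (2 * t))"
    by (simp only: of_real_eq_iff)
  then have "y' ^ 3 = inverse (exp (pi * t / 2 - pi / (2 * t)))"
    by (intro inverse_unique[symmetric]) (simp add: mult.commute)
  also have "\<dots> = exp (pi / (2 * t) - pi * t / 2)"
    by (simp flip: exp_minus)
  also have "\<dots> = exp (pi / (6 * t) - pi * t / 6) ^ 3"
    unfolding exp_of_nat_mult[symmetric] by (intro arg_cong[of _ _ exp]) (simp add: algebra_simps)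
  finally have "y' = exp (pi / (6 * t) - pi * t / 6)"
    by (rule power_eq_imp_eq_base) (use y' in auto)
  then show ?thesis
    by (simp add: C y')
qed

end

text \<open>Jacobi's imaginary transformation, for purely imaginary modulus.\<close>
theorem theta_transformation:
  assumes "t > 0"
  shows "theta (exp (- 2 * of_real pi / of_real t * u)) (exp (- 2 * of_real pi / of_real t)) =
    \<i> * of_real (exp (pi / (6 * t) - pi * t / 6)) *
    exp (of_real pi / of_real t * u\<^sup>2 - (of_real pi / of_real t + of_real pi * \<i>) * u) *
    theta (exp (2 * of_real pi * \<i> * u)) (exp (- 2 * of_real pi * of_real t))"
  using theta_side_eq_dual_side[OF assms, of u]
  by (simp add: theta_side_def[OF assms] dual_side_def[OF assms] coord_def[OF assms] nome_def[OF assms]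
      gaussian_def[OF assms] dual_coord_def[OF assms] dual_nome_def[OF assms] mult.assoc)

section \<open>Cubic periods and the quadratic Gauss sum modulo 13\<close>

definition cos13 :: "int \<Rightarrow> real" where
  "cos13 k = cos (2 * pi * k / 13)"

text \<open>Product-to-sum turns every quadratic expression in these cosines into a linear one; together with
  \<open>cos13_reduce\<close> and \<open>sum_cos13\<close> this decides all identities between periods below.\<close>
lemma cos13_mult: "cos13 i * cos13 j = (cos13 (i + j) + cos13 (i - j)) / 2"
  by (simp add: cos13_def cos_times_cos add_divide_distrib diff_divide_distrib ring_distribs)

text \<open>Variants that let the rewriting find a product inside a longer or a scaled one.\<close>
lemma cos13_mult_left:
  "cos13 i * (cos13 j * x) = (cos13 (i + j) + cos13 (i - j)) / 2 * x"
  "cos13 i * (numeral v * cos13 j) = numeral v * ((cos13 (i + j) + cos13 (i - j)) / 2)"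
  by (simp_all only: cos13_mult mult.left_commute[of "cos13 i" "numeral v"] flip: mult.assoc[of _ _ x])

lemma cos13_minus: "cos13 (- k) = cos13 k"
  by (simp add: cos13_def)

lemma cos13_reflect: "cos13 (13 - k) = cos13 k"
proof -
  have "cos13 (13 - k) = cos (2 * pi - 2 * pi * k / 13)"
    unfolding cos13_def by (intro arg_cong[of _ _ cos]) (simp add: field_simps)
  then show ?thesis
    by (simp add: cos13_def)
qed

lemma cos13_reduce:
  "cos13 0 = 1" "cos13 7 = cos13 6" "cos13 8 = cos13 5" "cos13 9 = cos13 4" "cos13 10 = cos13 3"
  "cos13 11 = cos13 2" "cos13 12 = cos13 1"
  using cos13_reflect[of 6] cos13_reflect[of 5] cos13_reflect[of 4] cos13_reflect[of 3]
    cos13_reflect[of 2] cos13_reflect[of 1]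
  by (simp_all add: cos13_def)

text \<open>Multiplying by \<open>2 sin (\<pi> / 13)\<close> makes the sum telescope.\<close>
lemma sum_cos13: "cos13 1 + cos13 2 + cos13 3 + cos13 4 + cos13 5 + cos13 6 = - 1 / 2"
proof -
  define \<theta> where "\<theta> = pi / 13"
  \<comment> \<open>The summand is a difference of sines at consecutive odd multiples of the angle.\<close>
  have step: "2 * sin \<theta> * cos13 k = sin ((2 * k + 1) * \<theta>) - sin ((2 * k - 1) * \<theta>)" for k
  proof -
    have *: "2 * pi * k / 13 = 2 * k * \<theta>"
      by (simp add: \<theta>_def)
    show ?thesis
      unfolding cos13_def * by (simp add: ring_distribs sin_add sin_diff)
  qed
  have "2 * sin \<theta> * (cos13 1 + cos13 2 + cos13 3 + cos13 4 + cos13 5 + cos13 6)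
      = sin (13 * \<theta>) - sin \<theta>"
    by (simp add: distrib_left step)
  then have "sin \<theta> * (2 * (cos13 1 + cos13 2 + cos13 3 + cos13 4 + cos13 5 + cos13 6) + 1) = 0"
    by (simp add: \<theta>_def algebra_simps)
  moreover have "sin \<theta> > 0"
    by (intro sin_gt_zero) (auto simp: \<theta>_def)
  ultimately have "2 * (cos13 1 + cos13 2 + cos13 3 + cos13 4 + cos13 5 + cos13 6) + 1 = 0"
    by (metis less_irrefl mult_eq_0_iff)
  then show ?thesis
    by simp
qed

text \<open>The Gauss sum of the quadratic character modulo 13: the squares are \<open>\<plusminus>1\<close>, \<open>\<plusminus>3\<close>, \<open>\<plusminus>4\<close>.\<close>
definition gauss13 :: real where
  "gauss13 = 2 * (cos13 1 + cos13 3 + cos13 4 - cos13 2 - cos13 5 - cos13 6)"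

lemma gauss13_square: "gauss13\<^sup>2 = 13"
proof -
  have "gauss13\<^sup>2 = 12 - 2 * (cos13 1 + cos13 2 + cos13 3 + cos13 4 + cos13 5 + cos13 6)"
    unfolding gauss13_def power_mult_distrib
    by (simp add: power2_eq_square algebra_simps cos13_mult cos13_mult_left cos13_minus cos13_reduce
      add_divide_distrib diff_divide_distrib)
  then show ?thesis
    by (simp add: sum_cos13)
qed

lemma four_sin_sin:
  "4 * sin (a * pi / 13) * sin (b * pi / 13) = 2 * (cos ((a - b) * pi / 13) - cos ((a + b) * pi / 13))"
  using sin_times_sin[of "a * pi / 13" "b * pi / 13"]
  by (simp add: diff_divide_distrib add_divide_distrib ring_distribs)

text \<open>Cosines of odd multiples of \<open>\<pi> / 13\<close> come from \<open>cos (\<pi> - x) = - cos x\<close>.\<close>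
lemma cos_odd_13: "cos ((13 - 2 * of_int k) * pi / 13) = - cos13 k"
proof -
  have "cos ((13 - 2 * of_int k) * pi / 13) = cos (pi - 2 * pi * k / 13)"
    by (intro arg_cong[of _ _ cos]) (simp add: field_simps)
  then show ?thesis by (simp add: cos13_def)
qed

lemma sines_eq_cos13:
  "4 * sin (1 * pi / 13) * sin (5 * pi / 13) = 2 * (cos13 2 - cos13 3)"
  "4 * sin (2 * pi / 13) * sin (3 * pi / 13) = 2 * (cos13 4 - cos13 6)"
  "4 * sin (4 * pi / 13) * sin (6 * pi / 13) = 2 * (cos13 1 - cos13 5)"
proof -
  have *: "cos (2 * pi / 13) = cos13 1" "cos (4 * pi / 13) = cos13 2" "cos (6 * pi / 13) = cos13 3"
    "cos (10 * pi / 13) = cos13 5"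
    by (simp_all add: cos13_def)
  have **: "cos (pi / 13) = - cos13 6" "cos (5 * pi / 13) = - cos13 4"
    using cos_odd_13[of 6] cos_odd_13[of 4] by simp_all
  show "4 * sin (1 * pi / 13) * sin (5 * pi / 13) = 2 * (cos13 2 - cos13 3)"
    "4 * sin (2 * pi / 13) * sin (3 * pi / 13) = 2 * (cos13 4 - cos13 6)"
    "4 * sin (4 * pi / 13) * sin (6 * pi / 13) = 2 * (cos13 1 - cos13 5)"
    unfolding four_sin_sin by (simp_all add: * **)
qed

lemma sin_13_pos: "0 < a \<Longrightarrow> a < 13 \<Longrightarrow> sin (a * pi / 13) > 0"
  by (intro sin_gt_zero) (auto simp: field_simps)

lemma gauss13_factorizations:
  "gauss13 = 4 * sin (1 * pi / 13) * sin (5 * pi / 13) * (2 * (cos13 2 + cos13 3 - cos13 4 - cos13 6))"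
  "gauss13 = 4 * sin (2 * pi / 13) * sin (3 * pi / 13) * (2 * (cos13 1 + cos13 5 - cos13 4 - cos13 6))"
  "gauss13 = 4 * sin (4 * pi / 13) * sin (6 * pi / 13) * (2 * (cos13 2 + cos13 3 - cos13 1 - cos13 5))"
  unfolding sines_eq_cos13 gauss13_def
  by (simp_all add: algebra_simps cos13_mult cos13_mult_left cos13_minus cos13_reduce
      add_divide_distrib diff_divide_distrib)

text \<open>The square is known, and the first factorization exhibits the sum as a product of positive
  factors: the arguments of \<open>cos13 2\<close> and \<open>cos13 3\<close> are below \<open>\<pi> / 2\<close>, those of \<open>cos13 4\<close> and \<open>cos13 6\<close>
  are above.\<close>
lemma gauss13_eq: "gauss13 = sqrt 13"
proof -
  have "cos13 2 > 0" "cos13 3 > 0" "cos (5 * pi / 13) > 0" "cos (pi / 13) > 0"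
    unfolding cos13_def by (auto intro!: cos_gt_zero simp: field_simps)
  then have "cos13 2 + cos13 3 - cos13 4 - cos13 6 > 0"
    using cos_odd_13[of 4] cos_odd_13[of 6] by simp
  then have "gauss13 > 0"
    unfolding gauss13_factorizations(1) by (intro mult_pos_pos sin_13_pos) auto
  then show ?thesis
    using gauss13_square by (simp add: real_sqrt_unique)
qed

lemma zeta13_powi: "zeta13 powi a + zeta13 powi (- a) = of_real (2 * cos13 a)"
proof -
  have "zeta13 powi k = cis (2 * pi * k / 13)" for k
    by (simp add: zeta13_def cis_conv_exp exp_power_int) (simp add: mult_ac)
  then show ?thesis
    by (simp add: cos13_def complex_eq_iff)
qed

lemma period_values:
  "period C0 = of_real (2 * (cos13 1 + cos13 5))"
  "period C1 = of_real (2 * (cos13 2 + cos13 3))"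
  "period C2 = of_real (2 * (cos13 4 + cos13 6))"
  using zeta13_powi[of 1] zeta13_powi[of 2] zeta13_powi[of 3] zeta13_powi[of 4] zeta13_powi[of 5] zeta13_powi[of 6]
  by (simp_all add: period_def C0_def C1_def C2_def add_ac)

lemma alpha_beta_gamma:
  "alpha = of_real (sqrt 13 / (4 * sin (1 * pi / 13) * sin (5 * pi / 13)))"
  "beta = of_real (sqrt 13 / (4 * sin (2 * pi / 13) * sin (3 * pi / 13)))"
  "gamma = of_real (sqrt 13 / (4 * sin (4 * pi / 13) * sin (6 * pi / 13)))"
proof -
  have pos: "sin (1 * pi / 13) > 0" "sin (2 * pi / 13) > 0" "sin (3 * pi / 13) > 0" 
    "sin (4 * pi / 13) > 0" "sin (5 * pi / 13) > 0" "sin (6 * pi / 13) > 0"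
    by (rule sin_13_pos; simp)+
  have div: "x = g / s" if "g = s * x" "s > 0" for x g s :: real
    using that by simp
  have eq1: "2 * (cos13 2 + cos13 3 - cos13 4 - cos13 6) = sqrt 13 / (4 * sin (1 * pi / 13) * sin (5 * pi / 13))"
    by (rule div, fold gauss13_eq, rule gauss13_factorizations, intro mult_pos_pos pos) simp
  show "alpha = of_real (sqrt 13 / (4 * sin (1 * pi / 13) * sin (5 * pi / 13)))"
    unfolding eq1[symmetric] by (simp add: alpha_def period_values algebra_simps)
  have eq2: "2 * (cos13 1 + cos13 5 - cos13 4 - cos13 6) = sqrt 13 / (4 * sin (2 * pi / 13) * sin (3 * pi / 13))"
    by (rule div, fold gauss13_eq, rule gauss13_factorizations, intro mult_pos_pos pos) simp
  show "beta = of_real (sqrt 13 / (4 * sin (2 * pi / 13) * sin (3 * pi / 13)))"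
    unfolding eq2[symmetric] by (simp add: beta_def period_values algebra_simps)
  have eq3: "2 * (cos13 2 + cos13 3 - cos13 1 - cos13 5) = sqrt 13 / (4 * sin (4 * pi / 13) * sin (6 * pi / 13))"
    by (rule div, fold gauss13_eq, rule gauss13_factorizations, intro mult_pos_pos pos) simp
  show "gamma = of_real (sqrt 13 / (4 * sin (4 * pi / 13) * sin (6 * pi / 13)))"
    unfolding eq3[symmetric] by (simp add: gamma_def period_values algebra_simps)
qed

section \<open>Radial asymptotics\<close>

text \<open>The part of the theta function at \<open>exp (2 \<pi> \<i> x)\<close> with nome \<open>exp (- 2 \<pi> t)\<close> that tends to \<open>1\<close> as \<open>t\<close>
  grows: its factor \<open>1 - exp (2 \<pi> \<i> x)\<close> is left out.\<close>
definition tail_product :: "real \<Rightarrow> real \<Rightarrow> complex" where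
  "tail_product x t = (let q = of_real (exp (- 2 * pi * t)) in
    qpoch (q * cis (2 * pi * x)) q * qpoch (q / cis (2 * pi * x)) q)"

text \<open>On the real line the factor \<open>1 - exp (2 \<pi> \<i> x)\<close>, the phase of the quadratic exponential and the
  constant \<open>\<i>\<close> combine to the sine.\<close>
lemma theta_real_transformation:
  assumes "t > 0"
  shows "theta (of_real (exp (- 2 * pi / t * x))) (of_real (exp (- 2 * pi / t))) =
    of_real (exp (pi / (6 * t) - pi * t / 6 + pi * (x\<^sup>2 - x) / t) * (2 * sin (pi * x))) * tail_product x t"
proof -
  define q where "q = complex_of_real (exp (- 2 * pi * t))"
  define w where "w = cis (2 * pi * x)"
  have q: "norm q < 1"
    using assms by (simp add: q_def)
  have e: "exp (- 2 * of_real pi / of_real t * of_real x) = complex_of_real (exp (- 2 * pi / t * x))"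
    "exp (- 2 * of_real pi / of_real t) = complex_of_real (exp (- 2 * pi / t))"
    "exp (- 2 * of_real pi * of_real t) = q"
    by (simp_all add: q_def flip: exp_of_real)
  have w: "exp (2 * of_real pi * \<i> * of_real x) = w"
    by (simp add: w_def cis_conv_exp mult_ac)
  have "of_real pi / of_real t * (of_real x)\<^sup>2 - (of_real pi / of_real t + of_real pi * \<i>) * of_real x
      = complex_of_real (pi * (x\<^sup>2 - x) / t) + \<i> * of_real (- pi * x)"
    using assms by (simp add: field_simps)
  then have g: "exp (of_real pi / of_real t * (of_real x)\<^sup>2 - (of_real pi / of_real t + of_real pi * \<i>) * of_real x)
      = of_real (exp (pi * (x\<^sup>2 - x) / t)) * cis (- pi * x)"
    by (simp only: exp_add exp_of_real cis_conv_exp)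
  have "theta w q = (1 - w) * tail_product x t"
    unfolding theta_def tail_product_def Let_def q_def[symmetric] w_def[symmetric]
    by (subst qpoch_rec[OF q]) (simp add: mult_ac)
  moreover have "\<i> * cis (- pi * x) * (1 - w) = of_real (2 * sin (pi * x))"
  proof -
    have "cis (- pi * x) * w = cis (pi * x)"
      by (simp add: w_def cis_mult)
    then have "\<i> * cis (- pi * x) * (1 - w) = \<i> * (cis (- pi * x) - cis (pi * x))"
      by (simp add: algebra_simps)
    also have "\<dots> = of_real (2 * sin (pi * x))"
      by (simp add: complex_eq_iff)
    finally show ?thesis .
  qed
  ultimately have s: "\<i> * cis (- pi * x) * theta w q = of_real (2 * sin (pi * x)) * tail_product x t"
    by (metis mult.assoc)
  have "theta (of_real (exp (- 2 * pi / t * x))) (of_real (exp (- 2 * pi / t))) =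
      of_real (exp (pi / (6 * t) - pi * t / 6) * exp (pi * (x\<^sup>2 - x) / t)) * (\<i> * cis (- pi * x) * theta w q)"
    using theta_transformation[OF assms, of "of_real x"] unfolding e g w by (simp add: mult_ac)
  then show ?thesis
    unfolding s by (simp add: exp_add mult_ac)
qed

lemma tail_product_bigo: "(\<lambda>t. tail_product x t - 1) \<in> O[at_top](\<lambda>t. of_real (exp (- 2 * pi * t)))"
proof -
  \<comment> \<open>A common bound for the two factors, from \<open>norm_qpoch_minus_1_le\<close>.\<close>
  define B where "B = (\<lambda>t::real. exp (exp (- 2 * pi * t) / (1 - exp (- 2 * pi * t))) - 1)"
  have bound: "norm (tail_product x t - 1) \<le> norm (B t + B t + B t * B t)" if t: "t > 0" for t
  proof -
    define q where "q = complex_of_real (exp (- 2 * pi * t))"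
    define w where "w = cis (2 * pi * x)"
    have q: "norm q < 1" "norm q = exp (- 2 * pi * t)"
      using t by (simp_all add: q_def)
    have f: "norm (qpoch (q * w) q - 1) \<le> B t" "norm (qpoch (q / w) q - 1) \<le> B t"
      using norm_qpoch_minus_1_le[OF q(1), of "q * w"] norm_qpoch_minus_1_le[OF q(1), of "q / w"]
      by (simp_all add: w_def norm_mult norm_divide q(2) B_def)
    then have "B t \<ge> 0"
      using norm_ge_zero order_trans by blast
    have "tail_product x t - 1 = (qpoch (q * w) q - 1) + (qpoch (q / w) q - 1)
        + (qpoch (q * w) q - 1) * (qpoch (q / w) q - 1)"
      by (simp add: tail_product_def Let_def q_def w_def algebra_simps)
    also have "norm \<dots> \<le> B t + B t + B t * B t"
      using f \<open>B t \<ge> 0\<close> by (intro norm_triangle_mono) (auto simp: norm_mult intro!: mult_mono)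
    finally show ?thesis by simp
  qed
  have "(\<lambda>t. tail_product x t - 1) \<in> O[at_top](\<lambda>t. complex_of_real (B t + B t + B t * B t))"
    by (intro bigoI[of _ 1] eventually_mono[OF eventually_gt_at_top[of 0]])
       (use bound in \<open>simp del: of_real_add of_real_mult\<close>)
  also have "(\<lambda>t. B t + B t + B t * B t) \<in> O[at_top](\<lambda>t. exp (- 2 * pi * t))"
    unfolding B_def by real_asymp
  then have "(\<lambda>t. complex_of_real (B t + B t + B t * B t)) \<in> O[at_top](\<lambda>t. of_real (exp (- 2 * pi * t)))"
    by (simp only: landau_o.big.of_real_iff)
  finally show ?thesis .
qed

lemma tail_product_tendsto: "(tail_product x \<longlongrightarrow> 1) at_top"
proof -
  have "(\<lambda>t. complex_of_real (exp (- 2 * pi * t))) \<in> o[at_top](\<lambda>_. 1)"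
  proof -
    have "(\<lambda>t::real. exp (- 2 * pi * t)) \<in> o[at_top](\<lambda>_. 1)"
      by real_asymp
    then show ?thesis
      using landau_o.small.of_real_iff[of "\<lambda>t. exp (- 2 * pi * t)" at_top "\<lambda>_. 1"] by simp
  qed
  from landau_o.big_small_trans[OF tail_product_bigo this, of x]
  have "((\<lambda>t. tail_product x t - 1) \<longlongrightarrow> 0) at_top"
    by (auto dest: smalloD_tendsto)
  then show ?thesis
    by (simp add: LIM_zero_iff)
qed

text \<open>The parameter \<open>t = 2 \<pi> / (13 \<epsilon>)\<close> is the one for which \<open>exp (- 2 \<pi> / t)\<close> is the nome
  \<open>exp (- 13 \<epsilon>)\<close> of the products.\<close>
definition tail_pair :: "real \<Rightarrow> real \<Rightarrow> real \<Rightarrow> complex" where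
  "tail_pair a b \<epsilon> = (let t = 2 * pi / (13 * \<epsilon>) in
    inverse (tail_product (a / 13) t * tail_product (b / 13) t))"

lemma filterlim_t: "filterlim (\<lambda>\<epsilon>::real. 2 * pi / (13 * \<epsilon>)) at_top (at_right 0)"
  by real_asymp

lemma tail_pair_tendsto: "(tail_pair a b \<longlongrightarrow> 1) (at_right 0)"
proof -
  have "((\<lambda>t. inverse (tail_product (a / 13) t * tail_product (b / 13) t)) \<longlongrightarrow> inverse (1 * 1)) at_top"
    by (intro tendsto_intros tail_product_tendsto) auto
  from filterlim_compose[OF this filterlim_t] show ?thesis
    by (simp add: tail_pair_def[abs_def] Let_def)
qed

lemma tail_pair_bigo:
  "(\<lambda>\<epsilon>. tail_pair a b \<epsilon> - 1) \<in> O[at_right 0](\<lambda>\<epsilon>. of_real (exp (- (4 * pi ^ 2 / (13 * \<epsilon>)))))"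
proof -
  let ?f = "tail_product (a / 13)" and ?g = "tail_product (b / 13)"
  let ?e = "\<lambda>t. complex_of_real (exp (- 2 * pi * t))"
  have lim: "((\<lambda>t. inverse (?f t * ?g t)) \<longlongrightarrow> inverse (1 * 1)) at_top"
    by (intro tendsto_intros tail_product_tendsto) auto
  have inv: "(\<lambda>t. inverse (?f t * ?g t)) \<in> O[at_top](\<lambda>_. 1)"
    by (rule bigoI_tendsto[of _ _ "inverse (1 * 1)"]) (use lim in simp_all)
  have g: "?g \<in> O[at_top](\<lambda>_. 1)"
    by (rule bigoI_tendsto[of _ _ 1]) (use tail_product_tendsto[of "b / 13"] in simp_all)
  \<comment> \<open>Use \<open>1 / (f g) - 1 = - ((f - 1) g + (g - 1)) / (f g)\<close>, whose factor \<open>1 / (f g)\<close> is bounded.\<close>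
  have "(\<lambda>t. (?f t - 1) * ?g t) \<in> O[at_top](?e)"
    using landau_o.big.mult[OF tail_product_bigo[of "a / 13"] g] by simp
  then have "(\<lambda>t. 0 - ((?f t - 1) * ?g t + (?g t - 1))) \<in> O[at_top](?e)"
    by (intro sum_in_bigo zero_in_bigo tail_product_bigo)
  from landau_o.big.mult[OF this inv]
  have "(\<lambda>t. (0 - ((?f t - 1) * ?g t + (?g t - 1))) * inverse (?f t * ?g t)) \<in> O[at_top](?e)"
    by simp
  also have "?this \<longleftrightarrow> (\<lambda>t. inverse (?f t * ?g t) - 1) \<in> O[at_top](?e)"
  proof (rule landau_o.big.in_cong)
    have "((\<lambda>t. ?f t * ?g t) \<longlongrightarrow> 1 * 1) at_top"
      by (intro tendsto_intros tail_product_tendsto)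
    then have "\<forall>\<^sub>F t in at_top. ?f t * ?g t \<noteq> 0"
      by (rule tendsto_imp_eventually_ne) simp
    then show "\<forall>\<^sub>F t in at_top. (0 - ((?f t - 1) * ?g t + (?g t - 1))) * inverse (?f t * ?g t) = inverse (?f t * ?g t) - 1"
      by eventually_elim (simp add: field_simps)
  qed
  finally have "(\<lambda>t. inverse (?f t * ?g t) - 1) \<in> O[at_top](?e)" .
  from landau_o.big.compose[OF this filterlim_t] show ?thesis
    by (simp add: tail_pair_def Let_def power2_eq_square mult_ac)
qed

text \<open>The transformation law at \<open>u = a / 13\<close> and \<open>t = 2 \<pi> / (13 \<epsilon>)\<close>, where \<open>exp (- 2 \<pi> u / t) = q\<^sup>a\<close>.\<close>
lemma qpoch_pair:
  assumes "\<epsilon> > 0" "a < 13"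
  defines "q \<equiv> complex_of_real (exp (- \<epsilon>))"
  shows "qpoch (q ^ a) (q ^ 13) * qpoch (q ^ (13 - a)) (q ^ 13) =
    of_real (exp (13 * \<epsilon> / 12 - pi\<^sup>2 / (39 * \<epsilon>) + (real a ^ 2 - 13 * real a) * \<epsilon> / 26) * (2 * sin (a * pi / 13)))
      * tail_product (a / 13) (2 * pi / (13 * \<epsilon>))"
proof -
  let ?t = "2 * pi / (13 * \<epsilon>)"
  have t: "?t > 0"
    using assms by simp
  have pow: "q ^ k = of_real (exp (- (k * \<epsilon>)))" for k
    by (simp add: q_def flip: of_real_power exp_of_nat_mult)
  have "q ^ (13 - a) = q ^ 13 / q ^ a"
    using assms by (intro power_diff) (auto simp: q_def)
  then have "qpoch (q ^ a) (q ^ 13) * qpoch (q ^ (13 - a)) (q ^ 13) = theta (q ^ a) (q ^ 13)"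
    by (simp add: theta_def)
  also have "\<dots> = theta (of_real (exp (- 2 * pi / ?t * (a / 13)))) (of_real (exp (- 2 * pi / ?t)))"
    using assms unfolding pow by (simp add: mult.commute)
  also have "\<dots> = of_real (exp (pi / (6 * ?t) - pi * ?t / 6 + pi * ((a / 13)\<^sup>2 - a / 13) / ?t) * (2 * sin (pi * (a / 13))))
      * tail_product (a / 13) ?t"
    by (rule theta_real_transformation[OF t])
  also have "pi / (6 * ?t) - pi * ?t / 6 + pi * ((a / 13)\<^sup>2 - a / 13) / ?t
      = 13 * \<epsilon> / 12 - pi\<^sup>2 / (39 * \<epsilon>) + (real a ^ 2 - 13 * real a) * \<epsilon> / 26"
    using assms by (simp add: field_simps power2_eq_square)
  finally show ?thesis
    by (simp add: mult.commute)
qed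

text \<open>The two contributions \<open>\<pi>\<^sup>2 / (39 \<epsilon>)\<close> do not depend on the residues \<open>a\<close> and \<open>b\<close>, so all three products
  grow at the same exponential rate; the residues enter through the sines and the exponent linear
  in \<open>\<epsilon>\<close>.\<close>
lemma inverse_pair_products:
  assumes "\<epsilon> > 0" "a < 13" "b < 13"
  defines "q \<equiv> complex_of_real (exp (- \<epsilon>))"
  shows "inverse (qpoch (q ^ a) (q ^ 13) * qpoch (q ^ (13 - a)) (q ^ 13)
      * (qpoch (q ^ b) (q ^ 13) * qpoch (q ^ (13 - b)) (q ^ 13))) =
    of_real (exp (2 * pi\<^sup>2 / (39 * \<epsilon>) - (13 / 6 - (13 * (real a + real b) - real a ^ 2 - real b ^ 2) / 26) * \<epsilon>)
      / (4 * sin (a * pi / 13) * sin (b * pi / 13))) * tail_pair a b \<epsilon>"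
proof -
  define A where "A = (\<lambda>a. 13 * \<epsilon> / 12 - pi\<^sup>2 / (39 * \<epsilon>) + (real a ^ 2 - 13 * real a) * \<epsilon> / 26)"
  have e: "2 * pi\<^sup>2 / (39 * \<epsilon>) - (13 / 6 - (13 * (real a + real b) - real a ^ 2 - real b ^ 2) / 26) * \<epsilon>
      = - (A a + A b)"
    using assms(1) by (simp add: A_def field_simps)
  have pair: "qpoch (q ^ k) (q ^ 13) * qpoch (q ^ (13 - k)) (q ^ 13)
      = of_real (exp (A k) * (2 * sin (k * pi / 13))) * tail_product (k / 13) (2 * pi / (13 * \<epsilon>))" if "k < 13" for k
    using qpoch_pair[OF assms(1) that] by (simp only: A_def q_def)
  have invert: "inverse (complex_of_real (x * u) * m * (complex_of_real (y * v) * m'))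
      = complex_of_real (inverse (x * y) / (u * v)) * inverse (m * m')" for x y u v :: real and m m'
    by (simp only: divide_inverse inverse_mult_distrib of_real_mult of_real_inverse mult_ac)
  have four: "4 * s * s' = (2 * s) * (2 * s')" for s s' :: real
    by simp
  show ?thesis
    unfolding pair[OF assms(2)] pair[OF assms(3)] e tail_pair_def Let_def invert exp_minus exp_add four ..
qed

lemma P_eq_pair_products:
  "P0 q = inverse (qpoch (q ^ 1) (q ^ 13) * qpoch (q ^ (13 - 1)) (q ^ 13)
      * (qpoch (q ^ 5) (q ^ 13) * qpoch (q ^ (13 - 5)) (q ^ 13)))"
  "P1 q = inverse (qpoch (q ^ 2) (q ^ 13) * qpoch (q ^ (13 - 2)) (q ^ 13)
      * (qpoch (q ^ 3) (q ^ 13) * qpoch (q ^ (13 - 3)) (q ^ 13)))"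
  "P2 q = inverse (qpoch (q ^ 4) (q ^ 13) * qpoch (q ^ (13 - 4)) (q ^ 13)
      * (qpoch (q ^ 6) (q ^ 13) * qpoch (q ^ (13 - 6)) (q ^ 13)))"
  by (simp_all add: P0_def P1_def P2_def qpoch_inf_def qpoch_def mult_ac)

text \<open>For the residues 1, 5 and 2, 3 the sum of \<open>a (13 - a)\<close> is \<open>52\<close>, so the coefficient of \<open>- \<epsilon>\<close> in the
  exponent is \<open>13/6 - 52/26 = 1/6\<close>. For 4, 6 it is \<open>78\<close>, which gives \<open>13/6 - 78/26 = - 5/6\<close>, and
  \<open>exp (5 \<epsilon> / 6)\<close> tends to \<open>1\<close>.\<close>
lemma P_exact:
  assumes "\<epsilon> > 0"
  shows "P0 (of_real (exp (- \<epsilon>))) =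
      of_real (1 / sqrt 13 * exp (2 * pi\<^sup>2 / (39 * \<epsilon>) - \<epsilon> / 6)) * (alpha * tail_pair 1 5 \<epsilon>)"
    and "P1 (of_real (exp (- \<epsilon>))) =
      of_real (1 / sqrt 13 * exp (2 * pi\<^sup>2 / (39 * \<epsilon>) - \<epsilon> / 6)) * (beta * tail_pair 2 3 \<epsilon>)"
    and "P2 (of_real (exp (- \<epsilon>))) =
      of_real (1 / sqrt 13 * exp (2 * pi\<^sup>2 / (39 * \<epsilon>) + 5 * \<epsilon> / 6)) * (gamma * tail_pair 4 6 \<epsilon>)"
proof -
  show "P0 (of_real (exp (- \<epsilon>))) =
      of_real (1 / sqrt 13 * exp (2 * pi\<^sup>2 / (39 * \<epsilon>) - \<epsilon> / 6)) * (alpha * tail_pair 1 5 \<epsilon>)"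
    using inverse_pair_products[OF assms, of 1 5] unfolding P_eq_pair_products alpha_beta_gamma by simp
  show "P1 (of_real (exp (- \<epsilon>))) =
      of_real (1 / sqrt 13 * exp (2 * pi\<^sup>2 / (39 * \<epsilon>) - \<epsilon> / 6)) * (beta * tail_pair 2 3 \<epsilon>)"
    using inverse_pair_products[OF assms, of 2 3] unfolding P_eq_pair_products alpha_beta_gamma by simp
  show "P2 (of_real (exp (- \<epsilon>))) =
      of_real (1 / sqrt 13 * exp (2 * pi\<^sup>2 / (39 * \<epsilon>) + 5 * \<epsilon> / 6)) * (gamma * tail_pair 4 6 \<epsilon>)"
    using inverse_pair_products[OF assms, of 4 6] unfolding P_eq_pair_products alpha_beta_gamma by simp
qed

lemma gamma_nonzero: "gamma \<noteq> 0"
  using sin_13_pos[of 4] sin_13_pos[of 6] by (simp add: alpha_beta_gamma)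

lemma norm_complex_2_le: "norm (E :: complex ^ 2) \<le> norm (E $ 1) + norm (E $ 2)"
  using L2_set_le_sum[of UNIV "\<lambda>i. norm (E $ i)"] by (simp add: norm_vec_def sum_2)

theorem proposition3p2:
  shows "(\<exists>E :: real \<Rightarrow> complex ^ 2.
            (\<lambda>\<epsilon>. norm (E \<epsilon>)) \<in> O[at_right 0](\<lambda>\<epsilon>. exp (- (4 * pi ^ 2 / (13 * \<epsilon>)))) \<and>
            (\<forall>\<epsilon>>0. vector [P0 (of_real (exp (- \<epsilon>))), P1 (of_real (exp (- \<epsilon>)))] =
               (1 / sqrt 13 * exp (2 * pi ^ 2 / (39 * \<epsilon>) - \<epsilon> / 6)) *\<^sub>R
                 (vector [alpha, beta] + E \<epsilon>)))
       \<and> (\<lambda>\<epsilon>. P2 (of_real (exp (- \<epsilon>)))) \<sim>[at_right 0]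
           (\<lambda>\<epsilon>. gamma * of_real (exp (Lam / \<epsilon>)) / of_real (sqrt 13))"
proof (intro conjI exI allI impI)
  define E :: "real \<Rightarrow> complex ^ 2" where
    "E = (\<lambda>\<epsilon>. vector [alpha * (tail_pair 1 5 \<epsilon> - 1), beta * (tail_pair 2 3 \<epsilon> - 1)])"
  have comp: "(\<lambda>\<epsilon>. norm (c * (tail_pair a b \<epsilon> - 1))) \<in> O[at_right 0](\<lambda>\<epsilon>. exp (- (4 * pi ^ 2 / (13 * \<epsilon>))))" for a b c
  proof -
    have "(\<lambda>\<epsilon>. c * (tail_pair a b \<epsilon> - 1)) \<in> O[at_right 0](\<lambda>\<epsilon>. complex_of_real (exp (- (4 * pi ^ 2 / (13 * \<epsilon>)))))"
      using tail_pair_bigo[of a b] by (cases "c = 0") simp_all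
    then have "(\<lambda>\<epsilon>. norm (c * (tail_pair a b \<epsilon> - 1)))
        \<in> O[at_right 0](\<lambda>\<epsilon>. norm (complex_of_real (exp (- (4 * pi ^ 2 / (13 * \<epsilon>))))))"
      by (simp only: landau_o.big.norm_iff)
    then show ?thesis
      by (simp only: norm_of_real abs_exp_cancel)
  qed
  have "(\<lambda>\<epsilon>. norm (E \<epsilon>)) \<in> O[at_right 0](\<lambda>\<epsilon>. norm (alpha * (tail_pair 1 5 \<epsilon> - 1)) + norm (beta * (tail_pair 2 3 \<epsilon> - 1)))"
    by (intro bigoI[of _ 1] always_eventually allI)
       (use norm_complex_2_le[of "E _"] in \<open>simp add: E_def\<close>)
  also have "(\<lambda>\<epsilon>. norm (alpha * (tail_pair 1 5 \<epsilon> - 1)) + norm (beta * (tail_pair 2 3 \<epsilon> - 1)))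
      \<in> O[at_right 0](\<lambda>\<epsilon>. exp (- (4 * pi ^ 2 / (13 * \<epsilon>))))"
    by (intro sum_in_bigo comp)
  finally show "(\<lambda>\<epsilon>. norm (E \<epsilon>)) \<in> O[at_right 0](\<lambda>\<epsilon>. exp (- (4 * pi ^ 2 / (13 * \<epsilon>))))" .
  show "vector [P0 (of_real (exp (- \<epsilon>))), P1 (of_real (exp (- \<epsilon>)))] =
      (1 / sqrt 13 * exp (2 * pi ^ 2 / (39 * \<epsilon>) - \<epsilon> / 6)) *\<^sub>R (vector [alpha, beta] + E \<epsilon>)"
    if "\<epsilon> > 0" for \<epsilon>
  proof -
    have add: "c + c * (x - 1) = c * x" for c x :: complex
      by (simp add: algebra_simps)
    show ?thesis
      unfolding P_exact[OF that] scaleR_conv_of_real[symmetric]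
      by (simp only: vec_eq_iff forall_2 vector_scaleR_component vector_add_component E_def vector_2 add)
  qed
next
  let ?g = "\<lambda>\<epsilon>. gamma * of_real (exp (Lam / \<epsilon>)) / of_real (sqrt 13)"
  have "((\<lambda>\<epsilon>::real. exp (5 * \<epsilon> / 6)) \<longlongrightarrow> 1) (at_right 0)"
    by real_asymp
  from tendsto_mult[OF tendsto_of_real[OF this] tail_pair_tendsto]
  have lim: "((\<lambda>\<epsilon>. of_real (exp (5 * \<epsilon> / 6)) * tail_pair 4 6 \<epsilon>) \<longlongrightarrow> 1) (at_right 0)"
    by simp
  have ev: "\<forall>\<^sub>F \<epsilon> in at_right 0.
      of_real (exp (5 * \<epsilon> / 6)) * tail_pair 4 6 \<epsilon> = P2 (of_real (exp (- \<epsilon>))) / ?g \<epsilon>"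
    using eventually_at_right_less[of 0]
  proof eventually_elim
    case (elim \<epsilon>)
    have "2 * pi\<^sup>2 / (39 * \<epsilon>) = Lam / \<epsilon>"
      by (simp add: Lam_def)
    then show ?case
      using gamma_nonzero unfolding P_exact(3)[OF elim] by (simp add: exp_add)
  qed
  have "((\<lambda>\<epsilon>. P2 (of_real (exp (- \<epsilon>))) / ?g \<epsilon>) \<longlongrightarrow> 1) (at_right 0)"
    by (rule Lim_transform_eventually[OF lim ev])
  then show "(\<lambda>\<epsilon>. P2 (of_real (exp (- \<epsilon>)))) \<sim>[at_right 0] ?g"
    by (rule asymp_equivI')
qed

end
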